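(* Let $n\ge k\ge 0$ be integers. Then $$\sum_{m=0}^{k}q^{\binom{m+1}{2}}\begin{bmatrix} n\\ m\end{bmatrix}_q\frac{(-q^{n-m+1};q)_m}{(q^{2n-m+1};q)_m}=\sum_{i=0}^{\lfloor k/2\rfloor}\frac{q^{i(2\lceil k/2\rceil+1)}\begin{bmatrix} n-k-1+i\\ i\end{bmatrix}_{q^2}}{(q;q^2)_{\lceil k/2\rceil}\,(q^{2n-1};q^{-2})_{\lfloor k/2\rfloor}}.$$
   Context: Notation: $(a;q)_m=\prod_{i=0}^{m-1}(1-aq^i)$, so $(q^{2n-1};q^{-2})_j=\prod_{i=0}^{j-1}(1-q^{2n-1-2i})$; and $\begin{bmatrix} N\\ m\end{bmatrix}_q=(q^{N-m+1};q)_m/(q;q)_m$ (in particular, when $n=k$, $\begin{bmatrix} i-1\\ i\end{bmatrix}_{q^2}$ is $1$ for $i=0$ and $0$ for $i>0$). *)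

theory Defs
  imports Complex_Main
begin

definition qpoch :: "'a::field \<Rightarrow> 'a \<Rightarrow> nat \<Rightarrow> 'a" where
  "qpoch a q m = (\<Prod>i<m. 1 - a * q ^ i)"

(* The upper entry is an integer: it equals -1 in the Gaussian coefficient
   [n-k-1+i, i] for n = k and i = 0. *)
definition qbinom :: "int \<Rightarrow> nat \<Rightarrow> 'a::field \<Rightarrow> 'a" where
  "qbinom N m q = qpoch (q powi (N - int m + 1)) q m / qpoch q q m"

end

(* Put z = q^(2n). The right side for k is a truncated 1phi0 series, and the full series
   F(b,y) = sum_i (b;Q)_i / (Q;Q)_i y^i with Q = q^2 satisfies F(b,Qy) = (1-y) F(bQ,y) and
   F(b,y) = (1-by) F(bQ,y). For the truncated series each relation acquires a single boundary
   term. With y = q^(2 ceil(k/2) + 1), passing from k to k + 1 is the first relation when k is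
   even and the second when k is odd, and the boundary term is the summand m = k + 1 on the
   left. *)

theory Submission
  imports Defs
begin

section \<open>Splitting and reversing q-Pochhammer products\<close>

lemma qpoch_0 [simp]: "qpoch a q 0 = 1"
  by (simp add: qpoch_def)

lemma qpoch_Suc: "qpoch a q (Suc m) = qpoch a q m * (1 - a * q ^ m)"
  by (simp add: qpoch_def)

lemma qpoch_Suc_left: "qpoch a q (Suc m) = (1 - a) * qpoch (a * q) q m"
  by (simp add: qpoch_def prod.lessThan_Suc_shift algebra_simps del: prod.lessThan_Suc)

lemma qpoch_nonzero: "(\<And>i. i < m \<Longrightarrow> a * q ^ i \<noteq> 1) \<Longrightarrow> qpoch a q m \<noteq> 0"
  by (auto simp: qpoch_def)

lemma qpoch_add: "qpoch a q (m + l) = qpoch a q m * qpoch (a * q ^ m) q l"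
  by (induction l) (simp_all add: qpoch_Suc power_add algebra_simps)

lemma qpoch_even: "qpoch a q (2 * p) = qpoch a (q ^ 2) p * qpoch (a * q) (q ^ 2) p"
  by (induction p) (simp_all add: qpoch_Suc algebra_simps flip: power_mult)

lemma qpoch_odd: "qpoch a q (Suc (2 * p)) = qpoch a (q ^ 2) (Suc p) * qpoch (a * q) (q ^ 2) p"
  by (simp add: qpoch_Suc[of a q "2 * p"] qpoch_Suc[of a "q ^ 2"] qpoch_even power_mult)

text \<open>As \<open>r\<close> is the inverse of \<open>q\<close>, the factors are the same ones,
  listed from last to first. This turns descending products into ascending ones.\<close>

lemma qpoch_reverse:
  assumes "q * r = 1"
  shows "qpoch (a * q ^ m) r (Suc m) = qpoch a q (Suc m)"
proof -
  have "q ^ m * r ^ (m - i) = q ^ i" if "i \<le> m" for i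
  proof -
    have "q ^ m * r ^ (m - i) = q ^ i * (q * r) ^ (m - i)"
      using that by (simp add: power_mult_distrib flip: power_add mult.assoc)
    then show ?thesis using assms by simp
  qed
  then show ?thesis
    unfolding qpoch_def
    by (subst prod.nat_diff_reindex[symmetric]) (auto intro!: prod.cong simp: mult.assoc)
qed

text \<open>Factorwise \<open>(1 - x) * (1 + x) = 1 - x ^ 2\<close>.\<close>

lemma qpoch_square_mult: "qpoch a q m * qpoch (- a) q m = qpoch (a ^ 2) (q ^ 2) m"
  by (induction m) (simp_all add: qpoch_Suc algebra_simps power2_eq_square power_mult_distrib)

text \<open>Division by the denominators in one step of the induction on k, with letters in place of
  products. The new denominator factor \<open>u\<close> joins \<open>A\<close> for even k and
  \<open>Z\<close> for odd k; \<open>E\<close> cancels within the new summand.\<close>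

lemma boundary_term_frac:
  fixes S :: "'a::field"
  assumes "S = u * S0 + N / Q * Y" "A \<noteq> 0" "Q \<noteq> 0" "E \<noteq> 0" "Z \<noteq> 0" "u \<noteq> 0"
  shows "S / (A * u * Z) = S0 / (A * Z) + Y * (E * N) / (A * u * Q * (E * Z))"
    and "S / (A * (Z * u)) = S0 / (A * Z) + Y * (E * N) / (A * Q * (E * (Z * u)))"
  using assms by (simp_all add: divide_simps)

section \<open>Coefficients and truncations of the 1phi0 series\<close>

definition qratio :: "'a::field \<Rightarrow> 'a \<Rightarrow> nat \<Rightarrow> 'a" where
  "qratio b Q i = qpoch b Q i / qpoch Q Q i"

lemma qratio_0 [simp]: "qratio b Q 0 = 1"
  by (simp add: qratio_def)

text \<open>Both sides share the factor \<open>qpoch (b * Q) Q p / qpoch Q Q (Suc p)\<close>; what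
  remains is \<open>(1 - b) * Q ^ Suc p = (1 - b * Q ^ Suc p) - (1 - Q ^ Suc p)\<close>.\<close>

lemma qratio_shift:
  assumes "qpoch Q Q (Suc p) \<noteq> 0"
  shows "qratio b Q (Suc p) * Q ^ Suc p = qratio (b * Q) Q (Suc p) - qratio (b * Q) Q p"
  using assms unfolding qratio_def qpoch_Suc_left[of b] qpoch_Suc[of Q] qpoch_Suc[of "b * Q"]
  by (simp add: field_simps)

text \<open>With the same common factor, what remains is
  \<open>1 - b = (1 - b * Q ^ Suc p) - b * (1 - Q ^ Suc p)\<close>.\<close>

lemma qratio_lower:
  assumes "qpoch Q Q (Suc p) \<noteq> 0"
  shows "qratio b Q (Suc p) = qratio (b * Q) Q (Suc p) - b * qratio (b * Q) Q p"
  using assms unfolding qratio_def qpoch_Suc_left[of b] qpoch_Suc[of Q] qpoch_Suc[of "b * Q"]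
  by (simp add: field_simps)

text \<open>By \<open>qratio_shift\<close> the coefficients agree up to degree \<open>p\<close>. The
  product with \<open>1 - y\<close> overshoots to degree \<open>Suc p\<close>, and the last term
  cancels the excess.\<close>

lemma truncated_shift:
  assumes "qpoch Q Q p \<noteq> 0"
  shows "(\<Sum>i\<le>p. qratio b Q i * (y * Q) ^ i)
       = (1 - y) * (\<Sum>i\<le>p. qratio (b * Q) Q i * y ^ i) + qratio (b * Q) Q p * y ^ Suc p"
  using assms
proof (induction p)
  case 0
  then show ?case by simp
next
  case (Suc p)
  then have "qpoch Q Q p \<noteq> 0" by (simp add: qpoch_Suc)
  note IH = Suc.IH[OF this]
  have "qratio b Q (Suc p) * (y * Q) ^ Suc p = (qratio b Q (Suc p) * Q ^ Suc p) * y ^ Suc p"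
    by (simp add: power_mult_distrib algebra_simps)
  then show ?case
    unfolding sum.atMost_Suc IH qratio_shift[OF Suc.prems] by (simp add: algebra_simps)
qed

text \<open>The left sum is one term longer, since \<open>k div 2\<close> grows when k is odd. In
  degree \<open>Suc p\<close> the product yields only the second part of the coefficient in
  \<open>qratio_lower\<close>; the last term supplies the first part.\<close>

lemma truncated_lower:
  assumes "qpoch Q Q (Suc p) \<noteq> 0"
  shows "(\<Sum>i\<le>Suc p. qratio b Q i * y ^ i)
       = (1 - b * y) * (\<Sum>i\<le>p. qratio (b * Q) Q i * y ^ i) + qratio (b * Q) Q (Suc p) * y ^ Suc p"
  using assms
proof (induction p)
  case 0
  then show ?case by (simp add: qratio_lower[of Q 0 b] algebra_simps)
next
  case (Suc p)
  then have "qpoch Q Q (Suc p) \<noteq> 0" by (simp add: qpoch_Suc)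
  note IH = Suc.IH[OF this]
  show ?case
    unfolding sum.atMost_Suc[of _ "Suc p"] IH qratio_lower[OF Suc.prems, of b]
    by (simp add: algebra_simps)
qed

section \<open>Induction on k\<close>

text \<open>With \<open>z\<close> free in place of \<open>q ^ (2 * n)\<close>, all products start at
  fixed points, and passing to \<open>Suc k\<close> replaces the series parameter b by
  \<open>b * r ^ 2\<close>, as the truncated relations require.\<close>

lemma partial_sum_eq:
  fixes q r z :: "'a::field"
  assumes qr: "q * r = 1"
    and "\<And>j. j \<in> {1..k} \<Longrightarrow> q ^ j \<noteq> 1"
    and "\<And>j. j < k \<Longrightarrow> z * r ^ j \<noteq> 1"
  shows "(\<Sum>m\<le>k. q ^ (Suc m choose 2) * qpoch z (r ^ 2) m / (qpoch q q m * qpoch z r m))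
       = (\<Sum>i\<le>k div 2. qratio (z * r ^ (2 * k)) (q ^ 2) i * (q ^ (2 * (Suc k div 2) + 1)) ^ i)
          / (qpoch q (q ^ 2) (Suc k div 2) * qpoch (z * r) (r ^ 2) (k div 2))"
  using assms(2,3)
proof (induction k)
  case 0
  then show ?case by (simp add: choose_two)
next
  case (Suc k)
  have nzq: "qpoch q q (Suc k) \<noteq> 0"
    using Suc.prems(1) by (intro qpoch_nonzero) (simp flip: power_Suc)
  have nzz: "qpoch z r (Suc k) \<noteq> 0"
    using Suc.prems(2) by (intro qpoch_nonzero) simp
  have IH: "(\<Sum>m\<le>k. q ^ (Suc m choose 2) * qpoch z (r ^ 2) m / (qpoch q q m * qpoch z r m))
       = (\<Sum>i\<le>k div 2. qratio (z * r ^ (2 * k)) (q ^ 2) i * (q ^ (2 * (Suc k div 2) + 1)) ^ i)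
          / (qpoch q (q ^ 2) (Suc k div 2) * qpoch (z * r) (r ^ 2) (k div 2))"
    using Suc by simp
  have qr2: "q ^ 2 * r ^ 2 = 1"
    using qr by (simp flip: power_mult_distrib)
  have qrm: "q ^ m * r ^ m = 1" for m
    using qr by (simp flip: power_mult_distrib)
  show ?case
  proof (cases "even k")
    case True
    then obtain p where k: "k = 2 * p" by blast
    \<comment> \<open>\<open>?b\<close> is the parameter at \<open>Suc k\<close>, so
      \<open>?b * q ^ 2\<close> is the one at \<open>k\<close>. The argument is \<open>?y\<close> at
      \<open>k\<close> and \<open>?y * q ^ 2\<close> at \<open>Suc k\<close>, and the denominator
      gains \<open>1 - ?y\<close>.\<close>
    let ?b = "z * r ^ (2 * Suc k)" and ?y = "q ^ Suc k"
    let ?A = "qpoch q (q ^ 2) p" and ?Z = "qpoch (z * r) (r ^ 2) p" and ?Q = "qpoch (q ^ 2) (q ^ 2) p"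
    have bQ: "?b * q ^ 2 = z * r ^ (2 * k)"
      using qr2 by (simp add: power2_eq_square algebra_simps)
    have q_split: "qpoch q q (Suc k) = ?A * (1 - ?y) * ?Q"
      unfolding k qpoch_odd by (simp add: qpoch_Suc[of q "q ^ 2"] power_mult flip: power2_eq_square)
    have z_split: "qpoch z r (Suc k) = qpoch z (r ^ 2) (Suc p) * ?Z"
      unfolding k qpoch_odd ..
    \<comment> \<open>The first \<open>Suc p\<close> factors cancel against the even-indexed half of
      \<open>qpoch z r (Suc k)\<close>. The other \<open>p\<close>, read backwards, ascend from
      \<open>?b * q ^ 2\<close>; reversal needs a last factor, hence the separate case
      \<open>p = 0\<close>.\<close>
    have num: "qpoch z (r ^ 2) (Suc k) = qpoch z (r ^ 2) (Suc p) * qpoch (?b * q ^ 2) (q ^ 2) p"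
    proof (cases p)
      case 0
      then show ?thesis by (simp add: k)
    next
      case (Suc l)
      have top: "z * (r ^ 2) ^ Suc p = (?b * q ^ 2) * (q ^ 2) ^ l"
      proof -
        have "(?b * q ^ 2) * (q ^ 2) ^ l = z * r ^ (2 * Suc p) * (q ^ (2 * l) * r ^ (2 * l))"
          unfolding bQ by (simp add: k Suc flip: power_mult power_add)
        then show ?thesis by (simp only: qrm mult_1_right power_mult[of r 2 "Suc p"])
      qed
      have len: "Suc k = Suc p + Suc l" by (simp add: k Suc)
      have "qpoch z (r ^ 2) (Suc k) = qpoch z (r ^ 2) (Suc p) * qpoch (z * (r ^ 2) ^ Suc p) (r ^ 2) (Suc l)"
        by (simp only: len qpoch_add[of z "r ^ 2" "Suc p" "Suc l"])
      then show ?thesis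
        unfolding top qpoch_reverse[OF qr2] by (simp only: Suc)
    qed
    have nz: "?A \<noteq> 0" "1 - ?y \<noteq> 0" "?Q \<noteq> 0" "qpoch z (r ^ 2) (Suc p) \<noteq> 0" "?Z \<noteq> 0"
      using nzq nzz unfolding q_split z_split by auto
    \<comment> \<open>The power of \<open>q\<close> in the new summand is thus
      \<open>?y ^ Suc p\<close>, as in the boundary term.\<close>
    have choose: "Suc (Suc k) choose 2 = Suc k * Suc p"
      by (simp add: k choose_two algebra_simps)
    have "(\<Sum>i\<le>p. qratio ?b (q ^ 2) i * (?y * q ^ 2) ^ i)
        = (1 - ?y) * (\<Sum>i\<le>p. qratio (?b * q ^ 2) (q ^ 2) i * ?y ^ i)
          + qratio (?b * q ^ 2) (q ^ 2) p * ?y ^ Suc p"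
      by (rule truncated_shift) (rule nz)
    then have "(\<Sum>i\<le>p. qratio ?b (q ^ 2) i * (?y * q ^ 2) ^ i) / (?A * (1 - ?y) * ?Z)
        = (\<Sum>i\<le>p. qratio (?b * q ^ 2) (q ^ 2) i * ?y ^ i) / (?A * ?Z)
          + q ^ (Suc (Suc k) choose 2) * qpoch z (r ^ 2) (Suc k) / (qpoch q q (Suc k) * qpoch z r (Suc k))"
      unfolding num q_split z_split choose power_mult qratio_def[of _ _ p]
      using nz by (intro boundary_term_frac(1))
    moreover have "qpoch q (q ^ 2) (Suc p) = ?A * (1 - ?y)"
      by (simp add: qpoch_Suc k power_mult)
    moreover have "q ^ (2 * Suc p + 1) = ?y * q ^ 2"
      by (simp add: k power2_eq_square)
    moreover have "Suc k div 2 = p" "k div 2 = p" "Suc (Suc k) div 2 = Suc p" "q ^ (2 * p + 1) = ?y"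
      by (simp_all add: k)
    ultimately show ?thesis
      unfolding sum.atMost_Suc[of _ k] IH by (simp only: bQ)
  next
    case False
    then obtain p where k: "k = Suc (2 * p)" by (auto elim: oddE)
    \<comment> \<open>Now \<open>?y\<close> is the argument both at \<open>k\<close> and at
      \<open>Suc k\<close>; only the parameter and the upper limit of the sum change.\<close>
    let ?b = "z * r ^ (2 * Suc k)" and ?y = "q ^ (2 * p + 3)"
    let ?A = "qpoch q (q ^ 2) (Suc p)" and ?Z = "qpoch (z * r) (r ^ 2) p" and ?Q = "qpoch (q ^ 2) (q ^ 2) (Suc p)"
    have Suck: "Suc k = 2 * Suc p" by (simp add: k)
    have bQ: "?b * q ^ 2 = z * r ^ (2 * k)"
      using qr2 by (simp add: power2_eq_square algebra_simps)
    \<comment> \<open>Hence \<open>1 - ?b * ?y\<close> is exactly the factor gained by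
      \<open>qpoch (z * r) (r ^ 2)\<close> when its length grows from \<open>p\<close> to
      \<open>Suc p\<close>.\<close>
    have by_eq: "?b * ?y = z * r * (r ^ 2) ^ p"
    proof -
      have "2 * Suc k = Suc (2 * p) + (2 * p + 3)" by (simp add: k)
      then have "?b * ?y = z * r ^ Suc (2 * p) * (q ^ (2 * p + 3) * r ^ (2 * p + 3))"
        by (simp only: power_add ac_simps)
      then show ?thesis by (simp add: qrm power_mult)
    qed
    have q_split: "qpoch q q (Suc k) = ?A * ?Q"
      unfolding Suck qpoch_even by (simp add: power2_eq_square)
    have z_split: "qpoch z r (Suc k) = qpoch z (r ^ 2) (Suc p) * (?Z * (1 - ?b * ?y))"
      unfolding Suck qpoch_even qpoch_Suc[of "z * r"] by (simp only: by_eq[unfolded Suck])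
    have num: "qpoch z (r ^ 2) (Suc k) = qpoch z (r ^ 2) (Suc p) * qpoch (?b * q ^ 2) (q ^ 2) (Suc p)"
    proof -
      have top: "z * (r ^ 2) ^ Suc p = (?b * q ^ 2) * (q ^ 2) ^ p"
      proof -
        have "(?b * q ^ 2) * (q ^ 2) ^ p = z * r ^ (2 * Suc p) * (q ^ (2 * p) * r ^ (2 * p))"
          unfolding bQ by (simp add: k flip: power_mult power_add)
        then show ?thesis by (simp only: qrm mult_1_right power_mult[of r 2 "Suc p"])
      qed
      have len: "Suc k = Suc p + Suc p" by (simp add: k)
      have "qpoch z (r ^ 2) (Suc k) = qpoch z (r ^ 2) (Suc p) * qpoch (z * (r ^ 2) ^ Suc p) (r ^ 2) (Suc p)"
        by (simp only: len qpoch_add[of z "r ^ 2" "Suc p" "Suc p"])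
      then show ?thesis
        by (simp only: top qpoch_reverse[OF qr2])
    qed
    have nz: "?A \<noteq> 0" "?Q \<noteq> 0" "qpoch z (r ^ 2) (Suc p) \<noteq> 0" "?Z \<noteq> 0" "1 - ?b * ?y \<noteq> 0"
      using nzq nzz unfolding q_split z_split by auto
    have choose: "Suc (Suc k) choose 2 = (2 * p + 3) * Suc p"
      by (simp add: k choose_two algebra_simps)
    have "(\<Sum>i\<le>Suc p. qratio ?b (q ^ 2) i * ?y ^ i)
        = (1 - ?b * ?y) * (\<Sum>i\<le>p. qratio (?b * q ^ 2) (q ^ 2) i * ?y ^ i)
          + qratio (?b * q ^ 2) (q ^ 2) (Suc p) * ?y ^ Suc p"
      by (rule truncated_lower) (rule nz)
    then have "(\<Sum>i\<le>Suc p. qratio ?b (q ^ 2) i * ?y ^ i) / (?A * (?Z * (1 - ?b * ?y)))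
        = (\<Sum>i\<le>p. qratio (?b * q ^ 2) (q ^ 2) i * ?y ^ i) / (?A * ?Z)
          + q ^ (Suc (Suc k) choose 2) * qpoch z (r ^ 2) (Suc k) / (qpoch q q (Suc k) * qpoch z r (Suc k))"
      unfolding num q_split z_split choose power_mult[of q "2 * p + 3"] qratio_def[of _ _ "Suc p"]
      using nz by (intro boundary_term_frac(2))
    moreover have "qpoch (z * r) (r ^ 2) (Suc p) = ?Z * (1 - ?b * ?y)"
      by (simp only: qpoch_Suc by_eq)
    moreover have "Suc k div 2 = Suc p" "k div 2 = p" "Suc (Suc k) div 2 = Suc p"
      "2 * Suc p + 1 = 2 * p + 3"
      by (simp_all add: k)
    ultimately show ?thesis
      unfolding sum.atMost_Suc[of _ k] IH by (simp only: bQ)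
  qed
qed

(* The assumption on q says that no denominator vanishes. The exponents of the factors
   1 - q^j in the denominators on the left are exactly those j listed, and
   those on the right are among them. A q that is transcendental over the prime field
   gives the identity of rational functions. *)
theorem mainTheorem6:
  fixes q :: "'a::field" and n k :: nat
  assumes "k \<le> n"
    and "\<And>j. j \<in> {1..k} \<union> {2*n-k+1..2*n} \<Longrightarrow> q ^ j \<noteq> 1"
  shows "(\<Sum>m=0..k. q ^ ((m + 1) choose 2) * qbinom (int n) m q
            * (qpoch (- (q ^ (n - m + 1))) q m / qpoch (q ^ (2*n - m + 1)) q m))
       = (\<Sum>i=0..k div 2.
            q ^ (i * (2 * ((k + 1) div 2) + 1))
              * qbinom (int n - int k - 1 + int i) i (q ^ 2)
            / (qpoch q (q ^ 2) ((k + 1) div 2) * qpoch (q ^ (2*n - 1)) (q powi (-2)) (k div 2)))"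
proof (cases "q = 0")
  \<comment> \<open>Here no inverse \<open>r\<close> exists; each side reduces to its term of index
    0, which is 1.\<close>
  case True
  have "0 < Suc m choose 2" if "0 < m" for m :: nat
    using that by (intro zero_less_binomial) simp
  then have vanish: "q ^ (Suc m choose 2) = 0" if "m \<noteq> 0" for m
    using True that by (simp only: zero_power neq0_conv)
  have "(\<Sum>m=0..k. q ^ ((m + 1) choose 2) * qbinom (int n) m q
            * (qpoch (- (q ^ (n - m + 1))) q m / qpoch (q ^ (2*n - m + 1)) q m))
      = (\<Sum>m=0..k. if m = 0 then 1 else 0)"
    by (rule sum.cong) (simp_all add: vanish qbinom_def choose_two[of "Suc 0"])
  \<comment> \<open>For \<open>k = 0\<close> the product is empty, whatever the truncated difference
    \<open>2*n - 1\<close> is; otherwise \<open>n\<close> is positive and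
    \<open>q ^ (2*n - 1) = 0\<close>.\<close>
  moreover have "qpoch (q ^ (2*n - 1)) (q powi (-2)) (k div 2) = 1"
    using True assms(1) by (cases "k = 0") (auto simp: qpoch_def zero_power)
  then have "(\<Sum>i=0..k div 2.
            q ^ (i * (2 * ((k + 1) div 2) + 1))
              * qbinom (int n - int k - 1 + int i) i (q ^ 2)
            / (qpoch q (q ^ 2) ((k + 1) div 2) * qpoch (q ^ (2*n - 1)) (q powi (-2)) (k div 2)))
      = (\<Sum>i=0..k div 2. if i = 0 then 1 else 0)"
    using True by (intro sum.cong) (auto simp: qbinom_def zero_power qpoch_def[of 0])
  ultimately show ?thesis by simp
next
  case False
  define r where "r = inverse q"
  define z where "z = q ^ (2 * n)"
  have qr: "q * r = 1" using False by (simp add: r_def)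
  have r_diff: "q ^ a * r ^ b = q ^ (a - b)" if "b \<le> a" for a b
    using False that by (simp add: r_def power_diff power_inverse divide_inverse)
  have left: "q ^ ((m + 1) choose 2) * qbinom (int n) m q
            * (qpoch (- (q ^ (n - m + 1))) q m / qpoch (q ^ (2*n - m + 1)) q m)
      = q ^ (Suc m choose 2) * qpoch z (r ^ 2) m / (qpoch q q m * qpoch z r m)" if "m \<le> k" for m
  proof (cases m)
    case 0
    then show ?thesis by (simp add: qbinom_def)
  next
    case (Suc l)
    have mn: "m \<le> n" using that assms(1) by simp
    have "q ^ (2*n - m + 1) * q ^ l = z"
      using Suc mn by (simp add: z_def flip: power_Suc power_add)
    then have "qpoch (q ^ (2*n - m + 1)) q m = qpoch z r m"
      using qpoch_reverse[OF qr, of "q ^ (2*n - m + 1)" l] Suc by simp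
    \<comment> \<open>The numerator of the Gaussian coefficient merges with the product at the
      negated argument into one in base \<open>q ^ 2\<close>, whose top factor has exponent
      \<open>2 * n\<close>.\<close>
    moreover have "qpoch (q ^ (n - m + 1)) q m * qpoch (- (q ^ (n - m + 1))) q m = qpoch z (r ^ 2) m"
    proof -
      have "(n - m + 1) * 2 + 2 * l = 2 * n" using Suc mn by simp
      then have "(q ^ (n - m + 1)) ^ 2 * (q ^ 2) ^ l = z"
        by (simp only: z_def flip: power_add power_mult)
      moreover have "q ^ 2 * r ^ 2 = 1" using qr by (simp flip: power_mult_distrib)
      ultimately show ?thesis
        using qpoch_reverse[of "q ^ 2" "r ^ 2" "(q ^ (n - m + 1)) ^ 2" l] Suc
        by (simp add: qpoch_square_mult)
    qed
    moreover have "q powi (int n - int m + 1) = q ^ (n - m + 1)"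
      using mn by (simp add: power_int_def nat_add_distrib nat_diff_distrib)
    ultimately show ?thesis
      by (simp add: qbinom_def mult.assoc)
  qed
  have "z * r ^ j \<noteq> 1" if "j < k" for j
  proof -
    have "2 * n - j \<in> {2 * n - k + 1..2 * n}" using assms(1) that by simp
    then have "q ^ (2 * n - j) \<noteq> 1" by (intro assms(2)) blast
    then show ?thesis using assms(1) that by (simp add: z_def r_diff)
  qed
  then have "(\<Sum>m\<le>k. q ^ (Suc m choose 2) * qpoch z (r ^ 2) m / (qpoch q q m * qpoch z r m))
       = (\<Sum>i\<le>k div 2. qratio (z * r ^ (2 * k)) (q ^ 2) i * (q ^ (2 * (Suc k div 2) + 1)) ^ i)
          / (qpoch q (q ^ 2) (Suc k div 2) * qpoch (z * r) (r ^ 2) (k div 2))"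
    using assms(2) by (intro partial_sum_eq[OF qr]) auto
  moreover have "qbinom (int n - int k - 1 + int i) i (q ^ 2) = qratio (z * r ^ (2 * k)) (q ^ 2) i" for i
  proof -
    \<comment> \<open>The \<open>i\<close> in the upper entry cancels, so the numerator starts at
      \<open>(q ^ 2) ^ (n - k)\<close> for every \<open>i\<close>. For \<open>n = k\<close> this is
      1, and the coefficients with \<open>i > 0\<close> vanish.\<close>
    have "int n - int k - 1 + int i - int i + 1 = int (n - k)" using assms(1) by simp
    moreover have "(q ^ 2) powi int (n - k) = z * r ^ (2 * k)"
      unfolding power_int_of_nat using assms(1)
      by (simp add: z_def r_diff diff_mult_distrib2 flip: power_mult)
    ultimately show ?thesis by (simp only: qbinom_def qratio_def)
  qed
  moreover have "qpoch (q ^ (2*n - 1)) (q powi (-2)) (k div 2) = qpoch (z * r) (r ^ 2) (k div 2)"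
  \<comment> \<open>A positive \<open>k\<close> forces \<open>n\<close> to be positive, so that
    \<open>2*n - 1\<close> is not truncated.\<close>
  proof (cases "k = 0")
    case False
    then have "z * r = q ^ (2*n - 1)"
      using r_diff[of 1 "2 * n"] assms(1) by (simp add: z_def)
    then show ?thesis by (simp add: r_def power_int_minus power_inverse)
  qed simp
  moreover have "q ^ (i * (2 * ((k + 1) div 2) + 1)) = (q ^ (2 * (Suc k div 2) + 1)) ^ i" for i
    unfolding power_mult[symmetric] by (simp only: mult.commute Suc_eq_plus1)
  moreover have "(\<Sum>m=0..k. q ^ ((m + 1) choose 2) * qbinom (int n) m q
            * (qpoch (- (q ^ (n - m + 1))) q m / qpoch (q ^ (2*n - m + 1)) q m))
      = (\<Sum>m\<le>k. q ^ (Suc m choose 2) * qpoch z (r ^ 2) m / (qpoch q q m * qpoch z r m))"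
    unfolding atLeast0AtMost by (intro sum.cong refl left) simp
  ultimately show ?thesis
    by (simp only: atLeast0AtMost sum_divide_distrib mult.commute Suc_eq_plus1)
qed

end
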